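(* For a Tychonoff space $X$, the following assertions are equivalent: (i) $X$ is an $s_{\mathbb{R}}$-space; (ii) for every locally compact sequential (Tychonoff) space $K$, the product $X\times K$ is an $s_{\mathbb{R}}$-space; (iii) for every locally compact sequential (Tychonoff) space $K$, each $s$-continuous function $f:X\times K\to\mathbb{R}$ is continuous.
   Context: All spaces are assumed to be Tychonoff. A function $f:Z\to\mathbb{R}$ is sequentially continuous ($s$-continuous) if the restriction of $f$ to each convergent sequence in $Z$ (together with its limit) is continuous; $Z$ is an $s_{\mathbb{R}}$-space if every $s$-continuous function $f:Z\to\mathbb{R}$ is continuous. A space $Z$ is sequential if for each non-closed subset $A\subseteq Z$ there is a sequence $\{a_n\}_{n\in\mathbb{N}}\subseteq A$ converging to some point $a\in\overline{A}\setminus A$. *)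

theory Defs
  imports "HOL-Analysis.Analysis"
begin

text \<open>The library's complete regularity does not include any separation axiom.\<close>

definition tychonoff_space :: "'a topology \<Rightarrow> bool" where
  "tychonoff_space X \<longleftrightarrow> completely_regular_space X \<and> Hausdorff_space X"

text \<open>A function on a space is represented by a total function on the underlying type;
  its values outside the topological carrier are irrelevant below.\<close>

definition s_continuous_map :: "'a topology \<Rightarrow> ('a \<Rightarrow> real) \<Rightarrow> bool" where
  "s_continuous_map Z f \<longleftrightarrow>
     (\<forall>(a::nat \<Rightarrow> 'a) l. range a \<subseteq> topspace Z \<and> limitin Z a l sequentially \<longrightarrow>
        continuous_map (subtopology Z (insert l (range a))) euclideanreal f)"

definition sR_space :: "'a topology \<Rightarrow> bool" where
  "sR_space Z \<longleftrightarrow>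
     (\<forall>f::'a \<Rightarrow> real. s_continuous_map Z f \<longrightarrow> continuous_map Z euclideanreal f)"

definition sequential_space :: "'a topology \<Rightarrow> bool" where
  "sequential_space Z \<longleftrightarrow>
     (\<forall>A. A \<subseteq> topspace Z \<and> \<not> closedin Z A \<longrightarrow>
        (\<exists>(a::nat \<Rightarrow> 'a) l. range a \<subseteq> A \<and> l \<in> Z closure_of A - A \<and>
           limitin Z a l sequentially))"

end

theory Submission
  imports Defs
begin

text \<open>For the main implication fix a point $(x_0, k_0)$ and a compact neighbourhood $C$ of $k_0$.
  In a sequential Hausdorff space the sequences in a compact set have convergent subsequences, hence
  $f(x_n, \cdot)$ converges to $f(x, \cdot)$ uniformly on $C$ whenever $x_n$ converges to $x$.
  Therefore $x \mapsto \sup_{k \in C} |f(x,k) - f(x_0,k)|$ is $s$-continuous, and so continuous, on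
  the $s_{\mathbb{R}}$-space $X$; it vanishes at $x_0$, and $f(x_0, \cdot)$ is continuous on the
  sequential space $K$. Conversely, take for $K$ a one-point space.\<close>

section \<open>Sequential continuity in terms of limits of sequences\<close>

lemma s_continuous_map_imp_tendsto:
  assumes "s_continuous_map Z f" "range a \<subseteq> topspace Z" "limitin Z a l sequentially"
  shows "(\<lambda>n. f (a n)) \<longlonglongrightarrow> f l"
proof -
  let ?S = "subtopology Z (insert l (range a))"
  have "continuous_map ?S euclideanreal f"
    using assms unfolding s_continuous_map_def by blast
  moreover have "limitin ?S a l sequentially"
    using assms(3) by (simp add: limitin_subtopology)
  ultimately have "limitin euclideanreal (f \<circ> a) (f l) sequentially"
    by (rule continuous_map_limit)
  then show ?thesis by (simp add: o_def)
qed

text \<open>A sequence with its limit is compact, so in a Hausdorff space preimages of closed sets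
  inside it are easily seen to be closed: one containing the limit is again compact, while one
  missing the limit is finite, because the values converge.\<close>

lemma Hausdorff_s_continuous_mapI:
  assumes Z: "Hausdorff_space Z"
    and f: "\<And>a l. \<lbrakk>range a \<subseteq> topspace Z; limitin Z a l sequentially\<rbrakk>
      \<Longrightarrow> (\<lambda>n. f (a n)) \<longlonglongrightarrow> f l"
  shows "s_continuous_map Z f"
  unfolding s_continuous_map_def
proof (intro allI impI, elim conjE)
  fix a :: "nat \<Rightarrow> 'a" and l
  assume a: "range a \<subseteq> topspace Z" and lim: "limitin Z a l sequentially"
  let ?S = "insert l (range a)"
  have l: "l \<in> topspace Z" using lim by (rule limitin_topspace)
  have tS: "topspace (subtopology Z ?S) = ?S" using a l by auto
  show "continuous_map (subtopology Z ?S) euclideanreal f"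
    unfolding continuous_map_closedin
  proof (intro conjI allI impI ballI)
    fix C :: "real set" assume "closedin euclideanreal C"
    then have C: "open (- C)" by (simp add: closed_def)
    let ?T = "{z \<in> topspace (subtopology Z ?S). f z \<in> C}"
    have T: "?T \<subseteq> ?S" by auto
    have "closedin Z ?T"
    proof (cases "f l \<in> C")
      case True
      then have "insert l (?T - {l}) = ?T" using tS by auto
      moreover have "compactin Z (insert l (?T - {l}))"
        by (rule compactin_sequence_with_limit[OF lim]) (use T a in auto)
      ultimately show ?thesis using Z compactin_imp_closedin by metis
    next
      case False
      then have "eventually (\<lambda>n. f (a n) \<in> - C) sequentially"
        using topological_tendstoD[OF f[OF a lim] C] by simp
      then obtain N where N: "\<And>n. n \<ge> N \<Longrightarrow> f (a n) \<notin> C"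
        unfolding eventually_sequentially by auto
      have "?T \<subseteq> a ` {..<N}"
      proof
        fix z assume z: "z \<in> ?T"
        with False tS obtain n where "z = a n" by auto
        with z N[of n] show "z \<in> a ` {..<N}" by (cases "n < N") auto
      qed
      then have "finite ?T" by (rule finite_subset) simp
      moreover have "?T \<subseteq> topspace Z" by auto
      ultimately show ?thesis
        using Z by (simp add: Hausdorff_imp_t1_space t1_space_closedin_finite[THEN iffD1, rule_format])
    qed
    then show "closedin (subtopology Z ?S) ?T"
      using T by (simp add: closedin_subset_topspace)
  qed simp
qed

text \<open>If the preimage of a closed set were not closed, some sequence in it would converge to a
  point outside it, yet the value at that point is a limit of values in the closed set.\<close>

lemma sequential_space_continuous_map:
  assumes K: "sequential_space K"
    and h: "\<And>a l. \<lbrakk>range a \<subseteq> topspace K; limitin K a l sequentially\<rbrakk>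
      \<Longrightarrow> (\<lambda>n. h (a n)) \<longlonglongrightarrow> h l"
  shows "continuous_map K euclideanreal (h :: 'a \<Rightarrow> real)"
  unfolding continuous_map_closedin
proof (intro conjI allI impI ballI)
  fix C :: "real set" assume "closedin euclideanreal C"
  then have C: "closed C" by simp
  let ?T = "{z \<in> topspace K. h z \<in> C}"
  show "closedin K ?T"
  proof (rule ccontr)
    assume "\<not> closedin K ?T"
    moreover have "?T \<subseteq> topspace K" by auto
    ultimately obtain a l where al: "range a \<subseteq> ?T" "l \<in> K closure_of ?T - ?T"
      "limitin K a l sequentially"
      using K unfolding sequential_space_def by meson
    have "(\<lambda>n. h (a n)) \<longlonglongrightarrow> h l" by (rule h) (use al in auto)
    then have "h l \<in> C"
      by (rule closed_sequentially[OF C, rotated]) (use al(1) in auto)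
    then show False using al limitin_topspace[OF al(3)] by auto
  qed
qed simp

section \<open>Sequential compactness of compact sets\<close>

lemma limitin_filterlim_compose:
  assumes "limitin X f l G" "filterlim r G F"
  shows "limitin X (\<lambda>i. f (r i)) l F"
  using assms unfolding limitin_def filterlim_iff by blast

lemma compactin_sequential_convergent_subsequence:
  assumes K: "sequential_space K" "t1_space K" and C: "compactin K C"
    and k: "\<And>n. k n \<in> C"
  obtains r :: "nat \<Rightarrow> nat" and l
  where "filterlim r at_top sequentially" "limitin K (\<lambda>i. k (r i)) l sequentially"
proof (rule ccontr)
  assume "\<not> thesis"
  with that have no: "\<And>r l. filterlim r at_top sequentially \<Longrightarrow>
      \<not> limitin K (\<lambda>i. k (r i)) l sequentially" by blast
  have CK: "C \<subseteq> topspace K" using C by (rule compactin_subset_topspace)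
  have closed: "closedin K (k ` {m..})" for m
  proof (rule ccontr)
    assume "\<not> closedin K (k ` {m..})"
    moreover have "k ` {m..} \<subseteq> topspace K" using k CK by auto
    ultimately obtain a l where al: "range a \<subseteq> k ` {m..}" "l \<notin> k ` {m..}"
      "limitin K a l sequentially"
      using K(1) unfolding sequential_space_def by (meson DiffD2)
    have "\<forall>i. \<exists>n\<ge>m. a i = k n" using al(1) by blast
    then obtain r where r: "\<And>i. r i \<ge> m" "\<And>i. a i = k (r i)" by metis
    have "filterlim r at_top sequentially"
      unfolding filterlim_at_top
    proof
      fix N
      \<comment> \<open>The limit \<open>l\<close> lies outside the tail and finite sets are closed,
        so the sequence eventually avoids the values at indices below \<open>N\<close>; this forces
        the chosen indices to infinity.\<close>
      have "closedin K (k ` {m..<N})"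
        using K(2) k CK by (auto intro!: t1_space_closedin_finite[THEN iffD1, rule_format])
      then have "openin K (topspace K - k ` {m..<N})" by blast
      moreover have "l \<in> topspace K - k ` {m..<N}"
        using al(2) limitin_topspace[OF al(3)] by auto
      ultimately have "eventually (\<lambda>i. a i \<in> topspace K - k ` {m..<N}) sequentially"
        using al(3) unfolding limitin_def by blast
      then show "eventually (\<lambda>i. N \<le> r i) sequentially"
      proof (rule eventually_mono)
        fix i assume "a i \<in> topspace K - k ` {m..<N}"
        with r[of i] show "N \<le> r i" by (metis DiffD2 atLeastLessThan_iff image_eqI not_le)
      qed
    qed
    moreover have "a = (\<lambda>i. k (r i))" using r(2) by auto
    ultimately show False using no al(3) by blast
  qed
  have "(\<Inter>m. k ` {m..}) \<noteq> {}"
  proof (rule compact_space_imp_nest)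
    show "compact_space (subtopology K C)" using C by (rule compact_space_subtopology)
    show "closedin (subtopology K C) (k ` {m..})" for m
      using closed k by (intro closedin_subset_topspace) auto
    show "decseq (\<lambda>m. k ` {m..})" by (auto simp: decseq_def)
  qed auto
  then obtain y where y: "y \<in> (\<Inter>m. k ` {m..})" unfolding ex_in_conv[symmetric] by (rule exE)
  have "\<forall>m. \<exists>n\<ge>m. k n = y"
  proof
    fix m
    have "y \<in> k ` {m..}" using y by (rule INT_D) simp
    then show "\<exists>n\<ge>m. k n = y" by auto
  qed
  then obtain r where r: "\<And>m. r m \<ge> m" "\<And>m. k (r m) = y" by metis
  have "filterlim r at_top sequentially"
    by (rule filterlim_at_top_mono[OF filterlim_ident]) (simp add: r)
  moreover have "y \<in> topspace K" using k[of "r 0"] CK r(2) by auto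
  then have "limitin K (\<lambda>i. k (r i)) y sequentially" by (simp add: r limitin_const)
  ultimately show False using no by blast
qed

section \<open>Uniform convergence on compact sets and the product theorem\<close>

lemma s_continuous_map_uniform_on_compactin:
  assumes f: "s_continuous_map (prod_topology X K) f"
    and K: "sequential_space K" "t1_space K" and C: "compactin K C"
    and a: "range a \<subseteq> topspace X" and lim: "limitin X a l sequentially" and e: "e > 0"
  shows "eventually (\<lambda>n. \<forall>k\<in>C. \<bar>f (a n, k) - f (l, k)\<bar> < e) sequentially"
proof (rule ccontr)
  assume "\<not> ?thesis"
  then have "\<forall>N. \<exists>n\<ge>N. \<exists>k\<in>C. \<bar>f (a n, k) - f (l, k)\<bar> \<ge> e"
    unfolding eventually_sequentially by (meson not_le)
  then obtain s k where s: "\<And>N. s N \<ge> N" and k: "\<And>N. k N \<in> C"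
    and far: "\<And>N. \<bar>f (a (s N), k N) - f (l, k N)\<bar> \<ge> e" by metis
  obtain r m where r: "filterlim r at_top sequentially"
    and m: "limitin K (\<lambda>i. k (r i)) m sequentially"
    by (rule compactin_sequential_convergent_subsequence[OF K C k])
  have CK: "C \<subseteq> topspace K" using C by (rule compactin_subset_topspace)
  have l: "l \<in> topspace X" using lim by (rule limitin_topspace)
  have "filterlim s at_top sequentially"
    by (rule filterlim_at_top_mono[OF filterlim_ident]) (simp add: s)
  then have "filterlim (\<lambda>i. s (r i)) at_top sequentially" using r by (rule filterlim_compose)
  then have a': "limitin X (\<lambda>i. a (s (r i))) l sequentially"
    by (rule limitin_filterlim_compose[OF lim])
  \<comment> \<open>The pairs \<open>(a (s (r i)), k (r i))\<close> and \<open>(l, k (r i))\<close>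
    both converge to \<open>(l, m)\<close>, so the difference of the values of \<open>f\<close>
    tends to 0, although it stays at least \<open>e\<close> in absolute value.\<close>
  have "(\<lambda>i. f (a (s (r i)), k (r i))) \<longlonglongrightarrow> f (l, m)"
    by (rule s_continuous_map_imp_tendsto[OF f])
      (use a k CK a' m in \<open>auto simp: limitin_pairwise o_def\<close>)
  moreover have "(\<lambda>i. f (l, k (r i))) \<longlonglongrightarrow> f (l, m)"
    by (rule s_continuous_map_imp_tendsto[OF f])
      (use l k CK m in \<open>auto simp: limitin_pairwise o_def limitin_const\<close>)
  ultimately have "(\<lambda>i. \<bar>f (a (s (r i)), k (r i)) - f (l, k (r i))\<bar>) \<longlonglongrightarrow> \<bar>f (l, m) - f (l, m)\<bar>"
    by (intro tendsto_intros)
  then have "e \<le> \<bar>f (l, m) - f (l, m)\<bar>"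
    by (rule tendsto_lowerbound) (simp_all add: far)
  with e show False by simp
qed

lemma sR_space_prod_topology:
  assumes X: "sR_space X" "Hausdorff_space X"
    and K: "Hausdorff_space K" "locally_compact_space K" "sequential_space K"
  shows "sR_space (prod_topology X K)"
  unfolding sR_space_def
proof (intro allI impI)
  fix f :: "'a \<times> 'b \<Rightarrow> real"
  assume f: "s_continuous_map (prod_topology X K) f"
  have K1: "t1_space K" using K(1) by (rule Hausdorff_imp_t1_space)
  have fK: "continuous_map K euclideanreal (\<lambda>k. f (x, k))" if "x \<in> topspace X" for x
  proof (rule sequential_space_continuous_map[OF K(3)])
    fix a l assume "range a \<subseteq> topspace K" "limitin K a l sequentially"
    then show "(\<lambda>n. f (x, a n)) \<longlonglongrightarrow> f (x, l)"
      by (intro s_continuous_map_imp_tendsto[OF f])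
        (use that in \<open>auto simp: limitin_pairwise o_def limitin_const\<close>)
  qed
  have nhd: "\<exists>W. openin (prod_topology X K) W \<and> (x0, k0) \<in> W \<and> (\<forall>z\<in>W. \<bar>f z - f (x0, k0)\<bar> < e)"
    if x0: "x0 \<in> topspace X" and k0: "k0 \<in> topspace K" and e: "e > 0" for x0 k0 e
  proof -
    obtain V C where V: "openin K V" "k0 \<in> V" "V \<subseteq> C" and C: "compactin K C"
      using K(2) k0 unfolding locally_compact_space_def by blast
    \<comment> \<open>\<open>g x\<close> is the uniform distance on \<open>C\<close> between the
      slices of \<open>f\<close> at \<open>x\<close> and at \<open>x0\<close>; it turns control for
      all \<open>k\<close> in \<open>C\<close> at once into continuity of one real function on
      \<open>X\<close>.\<close>
    define d where "d x k = \<bar>f (x, k) - f (x0, k)\<bar>" for x k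
    define g where "g x = (SUP k\<in>C. d x k)" for x
    have C0: "C \<noteq> {}" using V by auto
    \<comment> \<open>A real supremum bounds its family only if that family is bounded above; here
      this follows from continuity of the slices and compactness of \<open>C\<close>.\<close>
    have bdd: "bdd_above (d x ` C)" if "x \<in> topspace X" for x
    proof -
      have "continuous_map K euclideanreal (d x)"
        unfolding d_def
        by (intro continuous_map_real_abs continuous_map_diff fK that x0)
      then have "compactin euclideanreal (d x ` C)" by (rule image_compactin[OF C])
      then show ?thesis by (simp add: bounded_imp_bdd_above compact_imp_bounded)
    qed
    \<comment> \<open>The triangle inequality, passed to suprema. Applied in both directions, it
      turns uniform convergence of slices into convergence of \<open>g\<close>.\<close>
    have g_le: "g x \<le> g y + c"
      if "y \<in> topspace X" and "\<And>k. k \<in> C \<Longrightarrow> \<bar>f (x, k) - f (y, k)\<bar> \<le> c" for x y c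
      unfolding g_def
    proof (rule cSUP_least[OF C0])
      fix k assume k: "k \<in> C"
      have "d y k \<le> (SUP k\<in>C. d y k)" using k bdd[OF that(1)] by (intro cSUP_upper)
      with that(2)[OF k] show "d x k \<le> (SUP k\<in>C. d y k) + c" unfolding d_def by linarith
    qed
    have "s_continuous_map X g"
    proof (rule Hausdorff_s_continuous_mapI[OF X(2)])
      fix a l assume a: "range a \<subseteq> topspace X" and lim: "limitin X a l sequentially"
      have l: "l \<in> topspace X" using lim by (rule limitin_topspace)
      show "(\<lambda>n. g (a n)) \<longlonglongrightarrow> g l"
      proof (rule tendstoI)
        fix c :: real assume c: "c > 0"
        \<comment> \<open>Taking suprema weakens strict bounds to non-strict ones; the factor 1/2
          restores strictness.\<close>
        have "eventually (\<lambda>n. \<forall>k\<in>C. \<bar>f (a n, k) - f (l, k)\<bar> < c / 2) sequentially"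
          using c by (intro s_continuous_map_uniform_on_compactin[OF f K(3) K1 C a lim]) simp
        then show "eventually (\<lambda>n. dist (g (a n)) (g l) < c) sequentially"
        proof (rule eventually_mono)
          fix n assume n: "\<forall>k\<in>C. \<bar>f (a n, k) - f (l, k)\<bar> < c / 2"
          have "g (a n) \<le> g l + c / 2" by (rule g_le) (use n l in force)+
          moreover have "g l \<le> g (a n) + c / 2"
            by (rule g_le) (use n a in \<open>force simp: abs_minus_commute\<close>)+
          ultimately show "dist (g (a n)) (g l) < c" using c by (simp add: dist_real_def)
        qed
      qed
    qed
    then have g: "continuous_map X euclideanreal g" using X(1) unfolding sR_space_def by blast
    \<comment> \<open>The error is split along \<open>(x, k)\<close>, \<open>(x0, k)\<close>,
      \<open>(x0, k0)\<close>: \<open>U\<close> bounds the first move through \<open>g\<close>, as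
      \<open>V'\<close> lies in \<open>C\<close>, and \<open>V'\<close> bounds the second through
      continuity of the slice at \<open>x0\<close>.\<close>
    define U where "U = {x \<in> topspace X. g x \<in> {..<e / 2}}"
    define V' where "V' = V \<inter> {k \<in> topspace K. f (x0, k) \<in> ball (f (x0, k0)) (e / 2)}"
    have "openin X U" unfolding U_def by (rule openin_continuous_map_preimage[OF g]) simp
    moreover have "openin K V'" unfolding V'_def
      using V(1) by (intro openin_Int openin_continuous_map_preimage[OF fK[OF x0]]) auto
    ultimately have "openin (prod_topology X K) (U \<times> V')" by (simp add: openin_prod_Times_iff)
    moreover have "g x0 = 0" unfolding g_def d_def using C0 by simp
    then have "(x0, k0) \<in> U \<times> V'" using x0 k0 e V by (simp add: U_def V'_def)
    moreover have "\<bar>f z - f (x0, k0)\<bar> < e" if zUV: "z \<in> U \<times> V'" for z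
    proof -
      obtain x k where z: "z = (x, k)" "x \<in> U" "k \<in> V'" using zUV by blast
      then have "k \<in> C" using V by (auto simp: V'_def)
      then have "d x k \<le> g x"
        unfolding g_def using z(2) bdd[of x] by (intro cSUP_upper) (auto simp: U_def)
      then have "\<bar>f z - f (x0, k)\<bar> < e / 2" using z by (simp add: U_def d_def)
      moreover have "\<bar>f (x0, k0) - f (x0, k)\<bar> < e / 2" using z by (simp add: V'_def dist_real_def)
      ultimately show ?thesis by linarith
    qed
    ultimately show ?thesis by blast
  qed
  show "continuous_map (prod_topology X K) euclideanreal f"
    unfolding continuous_map
  proof (intro conjI allI impI)
    fix O' :: "real set" assume "openin euclideanreal O'"
    then have O': "open O'" by simp
    show "openin (prod_topology X K) {z \<in> topspace (prod_topology X K). f z \<in> O'}"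
    proof (subst openin_subopen, intro ballI)
      fix z assume z: "z \<in> {z \<in> topspace (prod_topology X K). f z \<in> O'}"
      then obtain e where e: "e > 0" "\<And>y. \<bar>y - f z\<bar> < e \<Longrightarrow> y \<in> O'"
        using openE[OF O', of "f z"] by (auto simp: subset_iff dist_real_def abs_minus_commute)
      obtain W where W: "openin (prod_topology X K) W" "z \<in> W" "\<forall>w\<in>W. \<bar>f w - f z\<bar> < e"
        using nhd[of "fst z" "snd z" e] z e(1) by auto
      moreover have "W \<subseteq> {z \<in> topspace (prod_topology X K). f z \<in> O'}"
        using e(2) W(3) openin_subset[OF W(1)] by blast
      ultimately show "\<exists>T. openin (prod_topology X K) T \<and> z \<in> T \<and>
          T \<subseteq> {z \<in> topspace (prod_topology X K). f z \<in> O'}" by blast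
    qed
  qed simp
qed

section \<open>The converse and the equivalences\<close>

lemma sR_space_prod_topology_imp_fst:
  assumes XK: "sR_space (prod_topology X K)" and k: "k \<in> topspace K"
    and H: "Hausdorff_space X" "Hausdorff_space K"
  shows "sR_space X"
  unfolding sR_space_def
proof (intro allI impI)
  fix f :: "'a \<Rightarrow> real" assume f: "s_continuous_map X f"
  \<comment> \<open>The projection preserves convergent sequences, so \<open>f\<close> lifts to the
    product; restricting the continuous lift to the section \<open>x \<mapsto> (x, k)\<close>
    recovers \<open>f\<close>.\<close>
  have "s_continuous_map (prod_topology X K) (\<lambda>z. f (fst z))"
  proof (rule Hausdorff_s_continuous_mapI)
    show "Hausdorff_space (prod_topology X K)" using H by (simp add: Hausdorff_space_prod_topology)
    fix a l assume "range a \<subseteq> topspace (prod_topology X K)"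
      and "limitin (prod_topology X K) a l sequentially"
    then show "(\<lambda>n. f (fst (a n))) \<longlonglongrightarrow> f (fst l)"
      by (intro s_continuous_map_imp_tendsto[OF f])
        (auto simp: limitin_pairwise o_def image_subset_iff mem_Times_iff)
  qed
  then have "continuous_map (prod_topology X K) euclideanreal (\<lambda>z. f (fst z))"
    using XK unfolding sR_space_def by blast
  moreover have "continuous_map X (prod_topology X K) (\<lambda>x. (x, k))"
    using k by (simp add: continuous_map_pairwise o_def)
  ultimately have "continuous_map X euclideanreal ((\<lambda>z. f (fst z)) \<circ> (\<lambda>x. (x, k)))"
    by (metis continuous_map_compose)
  then show "continuous_map X euclideanreal f" by (simp add: o_def)
qed

theorem theorem4p10:
  fixes X :: "'a topology"
  assumes "tychonoff_space X"
  shows "(sR_space X \<longleftrightarrow>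
           (\<forall>K :: 'b topology.
              tychonoff_space K \<and> locally_compact_space K \<and> sequential_space K \<longrightarrow>
              sR_space (prod_topology X K)))
       \<and> ((\<forall>K :: 'b topology.
              tychonoff_space K \<and> locally_compact_space K \<and> sequential_space K \<longrightarrow>
              sR_space (prod_topology X K)) \<longleftrightarrow>
           (\<forall>K :: 'b topology.
              tychonoff_space K \<and> locally_compact_space K \<and> sequential_space K \<longrightarrow>
              (\<forall>f :: 'a \<times> 'b \<Rightarrow> real. s_continuous_map (prod_topology X K) f \<longrightarrow>
                 continuous_map (prod_topology X K) euclideanreal f)))"
proof (rule conjI)
  let ?Q = "\<lambda>K :: 'b topology. tychonoff_space K \<and> locally_compact_space K \<and> sequential_space K"
  have X: "Hausdorff_space X" using assms by (simp add: tychonoff_space_def)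
  show "sR_space X \<longleftrightarrow> (\<forall>K. ?Q K \<longrightarrow> sR_space (prod_topology X K))"
  proof
    assume "sR_space X"
    then show "\<forall>K. ?Q K \<longrightarrow> sR_space (prod_topology X K)"
      using X by (simp add: sR_space_prod_topology tychonoff_space_def)
  next
    assume *: "\<forall>K. ?Q K \<longrightarrow> sR_space (prod_topology X K)"
    \<comment> \<open>Every type is inhabited, so a one-point space exists on \<open>'b\<close>; all
      its subsets are closed, which makes it sequential vacuously.\<close>
    let ?K = "discrete_topology {undefined :: 'b}"
    have "?Q ?K"
      by (simp add: tychonoff_space_def completely_regular_space_discrete_topology
          locally_compact_space_discrete_topology sequential_space_def)
    with * show "sR_space X"
      using X by (intro sR_space_prod_topology_imp_fst[of X ?K undefined]) auto
  qed
\<comment> \<open>The second equivalence only unfolds the definition of an s_R-space for the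
  product.\<close>
qed (simp add: sR_space_def)

end
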